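(* Let $\mathbb{F}$ be the field of real Puiseux series with its $\mathbb{Q}$-valuation $-\log|\cdot|$, and let $\mathcal{T}_{\mathbb{F}}$ be its associated $\mathbb{Q}$-tree. Then the segment completion tree $\mathcal{T}_{\mathbb{F}}^{\mathrm{sc}}$ is not a complete metric space.
   Context: Real Puiseux series: $\mathbb{F}$ is the field consisting of $0$ and all formal series $\sum_{k=-\infty}^{k_0} c_k X^{k/m}$ with $k_0,m\in\mathbb{Z}$, $m>0$, $c_k\in\mathbb{R}$, $c_{k_0}\neq 0$, with the order in which $X$ is larger than every real number (a nonzero series is positive iff its leading coefficient $c_{k_0}$ is positive). It is a real closed field. Write $\mathbb{F}_{>0}$ for its positive elements. The map $\log:\mathbb{F}_{>0}\to\mathbb{Q}$ is defined by $\log\left(\sum_{k=-\infty}^{k_0} c_k X^{k/m}\right)=k_0/m$ (where $c_{k_0}\ne 0$), and $\log(0):=-\infty$. The non-Archimedean hyperbolic plane: $\mathbb{H}_{\mathbb{F}}:=\{x+iy \mid x,y\in\mathbb{F},\ y>0\}\subseteq\mathbb{F}[i]$, $i^2=-1$, with the pseudo-distance, for $z=x+iy$ and $z'=x'+iy'$, $$d(z,z')=\log\left(\frac{(x-x')^2+y^2+y'^2}{yy'}\right)\in\mathbb{Q}_{\ge 0}.$$ The tree: $\mathcal{T}_{\mathbb{F}}:=\mathbb{H}_{\mathbb{F}}/\{d=0\}$ is the quotient identifying $z$ and $z'$ iff $d(z,z')=0$, with the induced $\mathbb{Q}$-valued metric, also denoted $d$. It is a $\mathbb{Q}$-tree (Brumfiel).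 Segments: a segment in $\mathcal{T}_{\mathbb{F}}$ is the image of a distance-preserving map $[a,b]_{\mathbb{Q}}=\{t\in\mathbb{Q}: a\le t\le b\}\to\mathcal{T}_{\mathbb{F}}$ for some $a\le b$ in $\mathbb{Q}$, where $[a,b]_{\mathbb{Q}}$ carries the distance $|t-t'|$. Segment completion tree: $\mathcal{T}_{\mathbb{F}}^{\mathrm{sc}}:=\bigcup_{s}\overline{s}$, the union over all segments $s$ in $\mathcal{T}_{\mathbb{F}}$ of the metric completion $\overline{s}$ of $s$. Here $\overline{s}$ is realized as the closure of $s$ in the metric completion of $\mathcal{T}_{\mathbb{F}}$ (regarded as a metric space with real-valued distance), and $\mathcal{T}_{\mathbb{F}}^{\mathrm{sc}}$ carries the restricted metric; $\mathcal{T}_{\mathbb{F}}$ embeds isometrically in it. *)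

theory Defs
  imports
    "HOL-Analysis.Analysis"
    "HOL-Computational_Algebra.Formal_Laurent_Series"
begin

unbundle fps_syntax

section \<open>The ordered field of real Puiseux series\<close>

text \<open>A series \<open>\<Sum>k\<le>k0. c_k X^(k/m)\<close> is represented by the function sending an exponent
  \<open>q\<close> to the coefficient of \<open>X^q\<close>; the exponents are bounded above and have a common denominator.\<close>

typedef puiseux =
  "{f :: rat \<Rightarrow> real. \<exists>(m::nat) (k0::int). m > 0 \<and>
      (\<forall>q. f q \<noteq> 0 \<longrightarrow> (\<exists>k\<le>k0. q = of_int k / of_nat m))}"
  morphisms pcoeff Abs_puiseux
  by (rule exI[of _ "\<lambda>_. 0"]) auto

setup_lifting type_definition_puiseux

lemma puiseux_eqI: "(\<And>q. pcoeff f q = pcoeff g q) \<Longrightarrow> f = g"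
  by (metis pcoeff_inject ext)

lemma coeff_supportE:
  obtains m :: nat and k0 :: int
  where "m > 0" "\<And>q. pcoeff f q \<noteq> 0 \<Longrightarrow> \<exists>k\<le>k0. q = of_int k / of_nat m"
  using pcoeff[of f] by blast

lemma le_common_denominator:
  assumes "m > 0" "n > 0" "k \<le> (k0::int)" "l \<le> (l0::int)"
  shows "\<exists>j\<le>max (k0 * int n) (l0 * int m). (of_int k / of_nat m :: rat) = of_int j / of_nat (m * n)"
    and "\<exists>j\<le>max (k0 * int n) (l0 * int m). (of_int l / of_nat n :: rat) = of_int j / of_nat (m * n)"
    and "\<exists>j\<le>k0 * int n + l0 * int m.
          (of_int k / of_nat m + of_int l / of_nat n :: rat) = of_int j / of_nat (m * n)"
proof -
  have a: "k * int n \<le> k0 * int n" "l * int m \<le> l0 * int m"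
    using assms by (simp_all add: mult_right_mono)
  show "\<exists>j\<le>max (k0 * int n) (l0 * int m). (of_int k / of_nat m :: rat) = of_int j / of_nat (m * n)"
    using a assms
    by (intro exI[of _ "k * int n"] conjI max.coboundedI1) (simp_all add: field_simps)
  show "\<exists>j\<le>max (k0 * int n) (l0 * int m). (of_int l / of_nat n :: rat) = of_int j / of_nat (m * n)"
    using a assms
    by (intro exI[of _ "l * int m"] conjI max.coboundedI2) (simp_all add: field_simps)
  show "\<exists>j\<le>k0 * int n + l0 * int m.
          (of_int k / of_nat m + of_int l / of_nat n :: rat) = of_int j / of_nat (m * n)"
    using a assms
    by (intro exI[of _ "k * int n + l * int m"] conjI add_mono) (simp_all add: field_simps)
qed

instantiation puiseux :: "{zero, one, plus, minus, uminus, times}"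
begin

lift_definition zero_puiseux :: puiseux is "\<lambda>_. 0"
  by auto

lift_definition one_puiseux :: puiseux is "\<lambda>q. if q = 0 then 1 else 0"
  by (rule exI[of _ 1], rule exI[of _ 0]) auto

lift_definition plus_puiseux :: "puiseux \<Rightarrow> puiseux \<Rightarrow> puiseux" is "\<lambda>f g q. f q + g q"
proof goal_cases
  case (1 f g)
  then obtain m k0 n l0 where
    "m > 0" "\<And>q. f q \<noteq> 0 \<Longrightarrow> \<exists>k\<le>k0::int. q = of_int k / of_nat m"
    "n > 0" "\<And>q. g q \<noteq> 0 \<Longrightarrow> \<exists>k\<le>l0::int. q = of_int k / of_nat n"
    by blast
  then show ?case
    using le_common_denominator(1)[of m n _ k0 l0 l0] le_common_denominator(2)[of m n k0 k0 _ l0]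
    by (intro exI[of _ "m * n"] exI[of _ "max (k0 * int n) (l0 * int m)"])
      (metis add_0 nat_0_less_mult_iff order_refl)
qed

lift_definition uminus_puiseux :: "puiseux \<Rightarrow> puiseux" is "\<lambda>f q. - f q"
  by simp

definition minus_puiseux :: "puiseux \<Rightarrow> puiseux \<Rightarrow> puiseux" where
  "f - g = f + - (g::puiseux)"

lift_definition times_puiseux :: "puiseux \<Rightarrow> puiseux \<Rightarrow> puiseux"
  is "\<lambda>f g q. \<Sum>r | f r \<noteq> 0 \<and> g (q - r) \<noteq> 0. f r * g (q - r)"
proof goal_cases
  case (1 f g)
  then obtain m k0 n l0 where *:
    "m > 0" "\<And>q. f q \<noteq> 0 \<Longrightarrow> \<exists>k\<le>k0::int. q = of_int k / of_nat m"
    "n > 0" "\<And>q. g q \<noteq> 0 \<Longrightarrow> \<exists>k\<le>l0::int. q = of_int k / of_nat n"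
    by blast
  have "\<exists>j\<le>k0 * int n + l0 * int m. q = of_int j / of_nat (m * n)"
    if "(\<Sum>r | f r \<noteq> 0 \<and> g (q - r) \<noteq> 0. f r * g (q - r)) \<noteq> 0" for q
  proof -
    have "{r. f r \<noteq> 0 \<and> g (q - r) \<noteq> 0} \<noteq> {}"
      using that by (intro notI) (simp only: sum.empty)
    then obtain r where "f r \<noteq> 0" "g (q - r) \<noteq> 0"
      by blast
    then obtain k l where "k \<le> k0" "r = of_int k / of_nat m" "l \<le> l0" "q - r = of_int l / of_nat n"
      using * by blast
    then show ?thesis
      using le_common_denominator(3)[of m n k k0 l l0] * by (metis add.commute diff_add_cancel)
  qed
  then show ?case
    using * by (intro exI[of _ "m * n"] exI[of _ "k0 * int n + l0 * int m"]) auto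
qed

instance ..

end

lemma coeff_add [simp]: "pcoeff (f + g) q = pcoeff f q + pcoeff g q"
  by transfer simp

lemma coeff_uminus [simp]: "pcoeff (- f) q = - pcoeff f q"
  by transfer simp

lemma coeff_diff [simp]: "pcoeff (f - g) q = pcoeff f q - pcoeff g q"
  by (simp add: minus_puiseux_def)

lemma coeff_zero [simp]: "pcoeff 0 q = 0"
  by transfer simp

lemma coeff_one: "pcoeff 1 q = (if q = 0 then 1 else 0)"
  by transfer simp

lemma coeff_mult:
  "pcoeff (f * g) q = (\<Sum>r | pcoeff f r \<noteq> 0 \<and> pcoeff g (q - r) \<noteq> 0. pcoeff f r * pcoeff g (q - r))"
  by transfer simp

text \<open>The field axioms are transferred from Laurent series in \<open>T = X^(-1/m)\<close>.\<close>

lift_definition of_fls :: "nat \<Rightarrow> real fls \<Rightarrow> puiseux"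
  is "\<lambda>m F q. if m > 0 \<and> q * of_nat m \<in> \<int> then F $$ (- \<lfloor>q * of_nat m\<rfloor>) else 0"
proof goal_cases
  case (1 m F)
  show ?case
  proof (cases "m > 0")
    case True
    have "\<exists>k\<le>- fls_subdegree F. q = of_int k / of_nat m"
      if "q * of_nat m \<in> \<int>" "F $$ (- \<lfloor>q * of_nat m\<rfloor>) \<noteq> 0" for q :: rat
    proof -
      have "q = of_int \<lfloor>q * of_nat m\<rfloor> / of_nat m"
        using that(1) True by (auto simp: field_simps elim!: Ints_cases)
      moreover have "fls_subdegree F \<le> - \<lfloor>q * of_nat m\<rfloor>"
        using that(2) by (rule fls_subdegree_leI)
      ultimately show ?thesis
        by (intro exI[of _ "\<lfloor>q * of_nat m\<rfloor>"]) linarith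
    qed
    then show ?thesis
      using True by (intro exI[of _ m] exI[of _ "- fls_subdegree F"]) auto
  qed auto
qed

lemma coeff_of_fls: "m > 0 \<Longrightarrow> pcoeff (of_fls m F) (of_int k / of_nat m) = F $$ (- k)"
  by (simp add: of_fls.rep_eq)

lemma coeff_of_fls_neg: "m > 0 \<Longrightarrow> pcoeff (of_fls m F) (- (of_int k / of_nat m)) = F $$ k"
  using coeff_of_fls[of m F "- k"] by simp

lemma coeff_of_fls_nonzeroE:
  assumes "pcoeff (of_fls m F) q \<noteq> 0"
  obtains k where "q = - (of_int k / of_nat m)" "F $$ k \<noteq> 0"
proof -
  have "m > 0" "q * of_nat m \<in> \<int>"
    using assms by (auto simp: of_fls.rep_eq split: if_splits)
  then have "q = - (of_int (- \<lfloor>q * of_nat m\<rfloor>) / of_nat m)"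
    by (auto simp: field_simps elim!: Ints_cases)
  then show thesis
    using assms coeff_of_fls_neg[OF \<open>m > 0\<close>] that by metis
qed

lemma of_fls_eqI:
  assumes "m > 0" "\<And>k. pcoeff f (- (of_int k / of_nat m)) = F $$ k"
    "\<And>q. pcoeff f q \<noteq> 0 \<Longrightarrow> \<exists>k. q = - (of_int k / of_nat m)"
  shows "f = of_fls m F"
proof (rule puiseux_eqI)
  fix q
  show "pcoeff f q = pcoeff (of_fls m F) q"
  proof (cases "\<exists>k. q = - (of_int k / of_nat m)")
    case True
    then show ?thesis
      using assms(1,2) coeff_of_fls_neg by auto
  next
    case False
    then show ?thesis
      using assms(3) coeff_of_fls_nonzeroE[of m F q] by metis
  qed
qed

lemma of_fls_exists:
  assumes m: "m > 0" and supp: "\<And>q. pcoeff f q \<noteq> 0 \<Longrightarrow> \<exists>k. q = of_int k / of_nat m"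
  shows "\<exists>F. f = of_fls m F"
proof -
  obtain n k0 where n: "n > 0" "\<And>q. pcoeff f q \<noteq> 0 \<Longrightarrow> \<exists>k\<le>k0::int. q = of_int k / of_nat n"
    using coeff_supportE by metis
  have bnd: "pcoeff f (- (of_int i / of_nat m)) = 0" if "i < - (\<bar>k0\<bar> * int m)" for i
  proof (rule ccontr)
    assume "pcoeff f (- (of_int i / of_nat m)) \<noteq> 0"
    then obtain k where k: "k \<le> k0" "- (of_int i / of_nat m) = (of_int k / of_nat n :: rat)"
      using n(2) by blast
    then have "(of_int (- i * int n) :: rat) = of_int (k * int m)"
      using m n(1) by (simp add: field_simps)
    then have "- i * int n = k * int m" by linarith
    moreover have "k * int m \<le> \<bar>k0\<bar> * int m"
      using k by (intro mult_right_mono) auto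
    moreover have "- i * 1 \<le> - i * int n"
      using that n(1) by (intro mult_left_mono) (auto intro: order_trans[OF less_imp_le])
    ultimately show False using that by linarith
  qed
  define F where "F = Abs_fls (\<lambda>i. pcoeff f (- (of_int i / of_nat m)))"
  have F: "F $$ i = pcoeff f (- (of_int i / of_nat m))" for i
    unfolding F_def using bnd by (intro nth_Abs_fls_ex_lower_bound exI[of _ "- (\<bar>k0\<bar> * int m)"]) auto
  have "f = of_fls m F"
  proof (rule of_fls_eqI[OF m])
    fix q assume "pcoeff f q \<noteq> 0"
    then obtain k where "q = of_int k / of_nat m" using supp by blast
    then show "\<exists>k. q = - (of_int k / of_nat m)" by (intro exI[of _ "- k"]) simp
  qed (simp add: F)
  then show ?thesis ..
qed

lemma common_of_fls:
  obtains m F G H where "m > 0" "f = of_fls m F" "g = of_fls m G" "h = of_fls m H"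
proof -
  have denom: "\<exists>m>0. \<forall>q. pcoeff f q \<noteq> 0 \<longrightarrow> (\<exists>k. q = of_int k / of_nat m)" for f
    using coeff_supportE[of f] by metis
  obtain m1 m2 m3 where m:
    "m1 > 0" "\<And>q. pcoeff f q \<noteq> 0 \<Longrightarrow> \<exists>k. q = of_int k / of_nat m1"
    "m2 > 0" "\<And>q. pcoeff g q \<noteq> 0 \<Longrightarrow> \<exists>k. q = of_int k / of_nat m2"
    "m3 > 0" "\<And>q. pcoeff h q \<noteq> 0 \<Longrightarrow> \<exists>k. q = of_int k / of_nat m3"
    using denom[of f] denom[of g] denom[of h] by blast
  have scale: "\<exists>l. (of_int k / of_nat i :: rat) = of_int l / of_nat (i * j)"
    if "i > 0" "j > 0" for i j :: nat and k :: int
    using that by (intro exI[of _ "k * int j"]) (simp add: field_simps)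
  let ?m = "m1 * m2 * m3"
  have "\<exists>F. f = of_fls ?m F"
    using m scale[of m1 "m2 * m3"] by (intro of_fls_exists) (simp, metis mult.assoc nat_0_less_mult_iff)
  moreover have "\<exists>G. g = of_fls ?m G"
    using m scale[of m2 "m1 * m3"]
    by (intro of_fls_exists) (simp, metis mult.assoc mult.commute nat_0_less_mult_iff)
  moreover have "\<exists>H. h = of_fls ?m H"
    using m scale[of m3 "m1 * m2"]
    by (intro of_fls_exists) (simp, metis mult.commute nat_0_less_mult_iff)
  ultimately show thesis using that[of ?m] m by auto
qed

lemma of_fls_add: "of_fls m F + of_fls m G = of_fls m (F + G)"
  by (rule puiseux_eqI) (simp add: of_fls.rep_eq)

lemma of_fls_uminus: "- of_fls m F = of_fls m (- F)"
  by (rule puiseux_eqI) (simp add: of_fls.rep_eq)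

lemma of_fls_zero: "of_fls m 0 = 0"
  by (rule puiseux_eqI) (simp add: of_fls.rep_eq)

lemma of_fls_one:
  assumes "m > 0"
  shows "of_fls m 1 = 1"
proof (rule of_fls_eqI[symmetric, OF assms])
  fix q assume "pcoeff 1 q \<noteq> 0"
  then show "\<exists>k. q = - (of_int k / of_nat m)"
    by (intro exI[of _ 0]) (simp add: coeff_one split: if_splits)
qed (use assms in \<open>simp add: coeff_one\<close>)

lemma of_fls_eq_zero_iff: "m > 0 \<Longrightarrow> of_fls m F = 0 \<longleftrightarrow> F = 0"
  by (metis coeff_of_fls_neg coeff_zero fls_eqI fls_zero_nth of_fls_zero)

lemma of_fls_mult:
  assumes m: "m > 0"
  shows "of_fls m F * of_fls m G = of_fls m (F * G)"
proof (rule of_fls_eqI[OF m])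
  fix n
  let ?e = "\<lambda>i::int. - (of_int i / of_nat m) :: rat"
  let ?I = "{i \<in> {fls_subdegree F..n - fls_subdegree G}. F $$ i \<noteq> 0 \<and> G $$ (n - i) \<noteq> 0}"
  have diff: "?e n - ?e i = ?e (n - i)" for i
    by (simp add: diff_divide_distrib)
  have inj: "inj_on ?e ?I"
    using m by (auto simp: inj_on_def)
  have "{r. pcoeff (of_fls m F) r \<noteq> 0 \<and> pcoeff (of_fls m G) (?e n - r) \<noteq> 0} = ?e ` ?I"
  proof (intro set_eqI iffI)
    fix r assume r: "r \<in> {r. pcoeff (of_fls m F) r \<noteq> 0 \<and> pcoeff (of_fls m G) (?e n - r) \<noteq> 0}"
    then obtain i where i: "r = ?e i" "F $$ i \<noteq> 0"
      using coeff_of_fls_nonzeroE by blast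
    then have "G $$ (n - i) \<noteq> 0"
      using r unfolding i(1) mem_Collect_eq diff coeff_of_fls_neg[OF m] by blast
    with i fls_subdegree_leI[of F i] fls_subdegree_leI[of G "n - i"] show "r \<in> ?e ` ?I"
      by auto
  next
    fix r assume "r \<in> ?e ` ?I"
    then obtain i where "r = ?e i" "F $$ i \<noteq> 0" "G $$ (n - i) \<noteq> 0" by blast
    then show "r \<in> {r. pcoeff (of_fls m F) r \<noteq> 0 \<and> pcoeff (of_fls m G) (?e n - r) \<noteq> 0}"
      unfolding mem_Collect_eq by (simp only: diff coeff_of_fls_neg[OF m]) simp
  qed
  then have "pcoeff (of_fls m F * of_fls m G) (?e n) =
      (\<Sum>r \<in> ?e ` ?I. pcoeff (of_fls m F) r * pcoeff (of_fls m G) (?e n - r))"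
    by (simp only: coeff_mult)
  also have "\<dots> = (\<Sum>i \<in> ?I. F $$ i * G $$ (n - i))"
    by (simp only: sum.reindex[OF inj] o_def diff coeff_of_fls_neg[OF m])
  also have "\<dots> = (\<Sum>i = fls_subdegree F..n - fls_subdegree G. F $$ i * G $$ (n - i))"
    by (intro sum.mono_neutral_left) auto
  also have "\<dots> = (F * G) $$ n"
    by (simp only: fls_times_nth(2))
  finally show "pcoeff (of_fls m F * of_fls m G) (?e n) = (F * G) $$ n" .
next
  fix q assume "pcoeff (of_fls m F * of_fls m G) q \<noteq> 0"
  then have "{r. pcoeff (of_fls m F) r \<noteq> 0 \<and> pcoeff (of_fls m G) (q - r) \<noteq> 0} \<noteq> {}"
    unfolding coeff_mult by (intro notI) (simp only: sum.empty)
  then obtain r where r: "pcoeff (of_fls m F) r \<noteq> 0" "pcoeff (of_fls m G) (q - r) \<noteq> 0"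
    by blast
  obtain i j where "r = - (of_int i / of_nat m)" "q - r = - (of_int j / of_nat m)"
    using coeff_of_fls_nonzeroE[OF r(1)] coeff_of_fls_nonzeroE[OF r(2)] by metis
  then show "\<exists>k. q = - (of_int k / of_nat m)"
    by (intro exI[of _ "i + j"]) (simp add: add_divide_distrib algebra_simps)
qed

instance puiseux :: comm_ring_1
proof
  fix f g h :: puiseux
  obtain m F G H where *: "m > 0" "f = of_fls m F" "g = of_fls m G" "h = of_fls m H"
    by (rule common_of_fls)
  show "f * g * h = f * (g * h)" "f * g = g * f" "1 * f = f" "(f + g) * h = f * h + g * h"
    by (simp_all add: * of_fls_mult of_fls_add of_fls_one[OF *(1), symmetric] algebra_simps)
  show "f + g + h = f + (g + h)" "f + g = g + f" "0 + f = f" "- f + f = 0" "f - g = f + - g"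
    by (rule puiseux_eqI; simp)+
  show "(0::puiseux) \<noteq> 1"
    by (metis coeff_one coeff_zero zero_neq_one)
qed

text \<open>The leading exponent. The convention \<open>log 0 = - \<infinity>\<close> is not represented:
  \<open>plog 0\<close> is unspecified, and \<open>plog\<close> is only ever relevant for nonzero series.\<close>

definition plog :: "puiseux \<Rightarrow> rat" where
  "plog f = (GREATEST q. pcoeff f q \<noteq> 0)"

abbreviation lead :: "puiseux \<Rightarrow> real" where
  "lead f \<equiv> pcoeff f (plog f)"

lemma plog_of_fls:
  assumes "m > 0" "F \<noteq> 0"
  shows "plog (of_fls m F) = - (of_int (fls_subdegree F) / of_nat m)"
    and "lead (of_fls m F) = F $$ fls_subdegree F"
proof -
  show *: "plog (of_fls m F) = - (of_int (fls_subdegree F) / of_nat m)"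
    unfolding plog_def
  proof (rule Greatest_equality)
    show "pcoeff (of_fls m F) (- (of_int (fls_subdegree F) / of_nat m)) \<noteq> 0"
      using assms by (simp add: coeff_of_fls_neg)
    fix q assume "pcoeff (of_fls m F) q \<noteq> 0"
    then obtain k where "q = - (of_int k / of_nat m)" "F $$ k \<noteq> 0"
      by (rule coeff_of_fls_nonzeroE)
    then show "q \<le> - (of_int (fls_subdegree F) / of_nat m)"
      using fls_subdegree_leI[of F k] assms(1) by (simp add: divide_right_mono)
  qed
  show "lead (of_fls m F) = F $$ fls_subdegree F"
    unfolding * by (rule coeff_of_fls_neg[OF assms(1)])
qed

lemma lead_eq_0_iff [simp]: "lead f = 0 \<longleftrightarrow> f = 0"
proof -
  obtain m F where *: "m > 0" "f = of_fls m F"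
    by (rule common_of_fls[of f f f])
  then show ?thesis
    by (cases "F = 0") (simp_all add: plog_of_fls(1) coeff_of_fls_neg of_fls_eq_zero_iff of_fls_zero)
qed

lemma le_plog:
  assumes "pcoeff f q \<noteq> 0"
  shows "q \<le> plog f"
proof -
  obtain m F where *: "m > 0" "f = of_fls m F"
    by (rule common_of_fls[of f f f])
  then obtain k where "q = - (of_int k / of_nat m)" "F $$ k \<noteq> 0"
    using assms coeff_of_fls_nonzeroE by blast
  then show ?thesis
    using fls_subdegree_leI[of F k] * plog_of_fls(1)[of m F]
    by (cases "F = 0") (auto simp: divide_right_mono)
qed

lemma plog_eqI: "pcoeff f p \<noteq> 0 \<Longrightarrow> (\<And>q. p < q \<Longrightarrow> pcoeff f q = 0) \<Longrightarrow> plog f = p"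
  by (metis coeff_zero lead_eq_0_iff le_plog linorder_not_less order_le_imp_less_or_eq)

lemma plog_mult:
  assumes "f \<noteq> 0" "g \<noteq> 0"
  shows "f * g \<noteq> 0" "plog (f * g) = plog f + plog g" "lead (f * g) = lead f * lead g"
proof -
  obtain m F G where *: "m > 0" "f = of_fls m F" "g = of_fls m G"
    by (rule common_of_fls[of f g g])
  then have nz: "F \<noteq> 0" "G \<noteq> 0" "F * G \<noteq> 0"
    using assms of_fls_zero by auto
  with * show "f * g \<noteq> 0"
    by (simp add: of_fls_mult of_fls_eq_zero_iff)
  show "plog (f * g) = plog f + plog g"
    using * nz by (simp add: of_fls_mult plog_of_fls add_divide_distrib)
  show "lead (f * g) = lead f * lead g"
    using * nz by (simp add: of_fls_mult plog_of_fls(2) fls_times_base)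
qed

lemma lead_uminus [simp]: "lead (- f) = - lead f"
  by (simp add: plog_def)

lemma lead_add_pos:
  assumes "lead f > 0" "lead g > 0"
  shows "lead (f + g) > 0" "plog (f + g) = max (plog f) (plog g)"
proof -
  let ?p = "max (plog f) (plog g)"
  have above: "pcoeff f q = 0" "pcoeff g q = 0" if "?p < q" for q
    using that le_plog[of f q] le_plog[of g q] by auto
  have zero: "pcoeff h p = 0" if "plog h < p" for h p
    using that le_plog[of h p] by auto
  have pos: "pcoeff (f + g) ?p > 0"
    using assms zero[of f "plog g"] zero[of g "plog f"]
    by (cases "plog f" "plog g" rule: linorder_cases) auto
  then show "plog (f + g) = ?p"
    by (intro plog_eqI) (auto simp: above)
  then show "lead (f + g) > 0"
    using pos by simp
qed

instantiation puiseux :: linordered_field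
begin

definition inverse_puiseux :: "puiseux \<Rightarrow> puiseux" where
  "inverse f = (if f = 0 then 0 else (THE g. f * g = (1::puiseux)))"

definition divide_puiseux :: "puiseux \<Rightarrow> puiseux \<Rightarrow> puiseux" where
  "f div g = f * inverse (g::puiseux)"

definition less_puiseux :: "puiseux \<Rightarrow> puiseux \<Rightarrow> bool" where
  "f < g \<longleftrightarrow> lead (g - f) > 0"

definition less_eq_puiseux :: "puiseux \<Rightarrow> puiseux \<Rightarrow> bool" where
  "f \<le> g \<longleftrightarrow> f = g \<or> f < (g::puiseux)"

definition abs_puiseux :: "puiseux \<Rightarrow> puiseux" where
  "\<bar>f\<bar> = (if f < 0 then - f else (f::puiseux))"

definition sgn_puiseux :: "puiseux \<Rightarrow> puiseux" where
  "sgn f = (if f = 0 then 0 else if 0 < f then 1 else - (1::puiseux))"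

instance
proof
  fix f g h :: puiseux
  show "inverse f * f = 1" if "f \<noteq> 0"
  proof -
    obtain m F where *: "m > 0" "f = of_fls m F"
      by (rule common_of_fls[of f f f])
    then have "F \<noteq> 0"
      using that of_fls_zero by auto
    then have ex: "f * of_fls m (inverse F) = 1"
      using * by (simp add: of_fls_mult of_fls_one)
    have "f * (THE g. f * g = 1) = 1"
    proof (rule theI[of _ "of_fls m (inverse F)"])
      fix g assume "f * g = 1"
      then show "g = of_fls m (inverse F)"
        using ex by (metis mult.assoc mult.commute mult_1)
    qed (rule ex)
    then show ?thesis
      using that by (simp add: inverse_puiseux_def mult.commute)
  qed
  show "f div g = f * inverse g"
    by (rule divide_puiseux_def)
  show "inverse (0::puiseux) = 0"
    by (simp add: inverse_puiseux_def)
  have trans: "a < c" if "a < b" "b < c" for a b c :: puiseux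
    using lead_add_pos(1)[of "b - a" "c - b"] that by (simp only: less_puiseux_def) simp
  have irrefl: "\<not> a < a" for a :: puiseux
    by (simp add: less_puiseux_def)
  show "f < g \<longleftrightarrow> f \<le> g \<and> \<not> g \<le> f"
    using trans[of f g f] irrefl[of f] unfolding less_eq_puiseux_def by auto
  show "f \<le> f"
    by (simp add: less_eq_puiseux_def)
  show "f \<le> h" if "f \<le> g" "g \<le> h"
    using that trans[of f g h] unfolding less_eq_puiseux_def by auto
  show "f = g" if "f \<le> g" "g \<le> f"
    using that trans[of f g f] irrefl[of f] unfolding less_eq_puiseux_def by auto
  show "f \<le> g \<or> g \<le> f"
  proof -
    have "lead (f - g) = - lead (g - f)"
      using lead_uminus[of "g - f"] by simp
    then show ?thesis
      using lead_eq_0_iff[of "g - f"] unfolding less_eq_puiseux_def less_puiseux_def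
      by (metis eq_iff_diff_eq_0 linorder_neqE neg_0_less_iff_less)
  qed
  show "h + f \<le> h + g" if "f \<le> g"
    using that by (auto simp: less_eq_puiseux_def less_puiseux_def)
  show "h * f < h * g" if "f < g" "0 < h"
  proof -
    have "g - f \<noteq> 0" "h \<noteq> 0"
      using that irrefl by auto
    then have "lead (h * (g - f)) > 0"
      using plog_mult(3)[of h "g - f"] that by (simp add: less_puiseux_def)
    then show ?thesis
      by (simp add: less_puiseux_def algebra_simps)
  qed
  show "\<bar>f\<bar> = (if f < 0 then - f else f)"
    by (rule abs_puiseux_def)
  show "sgn f = (if f = 0 then 0 else if 0 < f then 1 else - 1)"
    by (rule sgn_puiseux_def)
qed

end

lemma puiseux_pos_iff: "0 < f \<longleftrightarrow> lead f > 0"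
  by (simp add: less_puiseux_def)

lemma plog_add_pos: "0 < f \<Longrightarrow> 0 < g \<Longrightarrow> plog (f + g) = max (plog f) (plog g)"
  by (simp add: puiseux_pos_iff lead_add_pos)

lemma plog_divide:
  assumes "f \<noteq> 0" "g \<noteq> 0"
  shows "plog (f / g) = plog f - plog g"
  using plog_mult(2)[of "f / g" g] assms by simp

lemma plog_power2: "f \<noteq> 0 \<Longrightarrow> plog (f\<^sup>2) = 2 * plog f"
  by (simp add: power2_eq_square plog_mult)

lemma plog_add_le:
  assumes "f + g \<noteq> 0" "f = 0 \<or> plog f \<le> a" "g = 0 \<or> plog g \<le> a"
  shows "plog (f + g) \<le> a"
proof -
  have "pcoeff f (plog (f + g)) \<noteq> 0 \<or> pcoeff g (plog (f + g)) \<noteq> 0"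
    using assms(1) lead_eq_0_iff[of "f + g"] by auto
  then show ?thesis
    using assms le_plog by (metis coeff_zero order_trans)
qed

unbundle no fps_syntax


section \<open>The non-Archimedean hyperbolic plane and its tree\<close>

typedef hplane = "{z :: puiseux \<times> puiseux. snd z > 0}"
  by (rule exI[of _ "(0, 1)"]) simp

definition re :: "hplane \<Rightarrow> puiseux" where
  "re z = fst (Rep_hplane z)"

definition im :: "hplane \<Rightarrow> puiseux" where
  "im z = snd (Rep_hplane z)"

lemma im_pos [simp]: "im z > 0"
  using Rep_hplane[of z] by (auto simp: im_def)

definition hdist :: "hplane \<Rightarrow> hplane \<Rightarrow> rat" where
  "hdist z w = plog (((re z - re w)\<^sup>2 + (im z)\<^sup>2 + (im w)\<^sup>2) / (im z * im w))"

lemma im_nonzero [simp]: "im z \<noteq> 0"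
  using im_pos[of z] by (metis less_irrefl)

lemma hdist_bounds:
  obtains M where "hdist z w = 2 * M - plog (im z) - plog (im w)"
    "\<And>a. (plog (im z) \<le> a \<and> plog (im w) \<le> a \<and> (re z = re w \<or> plog (re z - re w) \<le> a)) \<longleftrightarrow> M \<le> a"
proof -
  let ?x = "re z - re w"
  let ?M = "max (plog (im z)) (plog (im w))"
  have ims: "(im z)\<^sup>2 + (im w)\<^sup>2 > 0" "(im z)\<^sup>2 > 0" "(im w)\<^sup>2 > 0" "im z \<noteq> 0" "im w \<noteq> 0"
    by (simp_all add: add_pos_pos zero_less_power)
  have M: "plog ((im z)\<^sup>2 + (im w)\<^sup>2) = 2 * ?M"
    using ims by (simp add: plog_add_pos plog_power2 max_def)
  define N where "N = (if ?x = 0 then ?M else max (plog ?x) ?M)"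
  have "plog (?x\<^sup>2 + ((im z)\<^sup>2 + (im w)\<^sup>2)) = 2 * N"
    using plog_add_pos[of "?x\<^sup>2" "(im z)\<^sup>2 + (im w)\<^sup>2"] ims M
    by (auto simp: N_def plog_power2 max_def)
  moreover have "?x\<^sup>2 + ((im z)\<^sup>2 + (im w)\<^sup>2) > 0"
    using ims by (simp add: add_nonneg_pos)
  ultimately have "hdist z w = 2 * N - plog (im z) - plog (im w)"
    using ims by (simp add: hdist_def plog_divide plog_mult add.assoc)
  moreover have "(plog (im z) \<le> a \<and> plog (im w) \<le> a \<and> (re z = re w \<or> plog (re z - re w) \<le> a)) \<longleftrightarrow> N \<le> a" for a
    by (auto simp: N_def)
  ultimately show thesis
    by (rule that)
qed

lemma hdist_self: "hdist z z = 0"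
proof -
  obtain M where "hdist z z = 2 * M - plog (im z) - plog (im z)" "\<And>a. plog (im z) \<le> a \<longleftrightarrow> M \<le> a"
    using hdist_bounds[of z z] by auto
  then show ?thesis
    by (metis diff_diff_eq mult_2 order_antisym order_refl right_minus_eq)
qed

lemma hdist_commute: "hdist z w = hdist w z"
  by (simp add: hdist_def power2_commute[of "re z"] add_ac mult.commute)

lemma hdist_triangle: "hdist z w \<le> hdist z u + hdist u w"
proof -
  obtain A where A: "hdist z u = 2 * A - plog (im z) - plog (im u)"
    "\<And>a. (plog (im z) \<le> a \<and> plog (im u) \<le> a \<and> (re z = re u \<or> plog (re z - re u) \<le> a)) \<longleftrightarrow> A \<le> a"
    by (rule hdist_bounds[of z u]) (rule that)
  obtain B where B: "hdist u w = 2 * B - plog (im u) - plog (im w)"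
    "\<And>a. (plog (im u) \<le> a \<and> plog (im w) \<le> a \<and> (re u = re w \<or> plog (re u - re w) \<le> a)) \<longleftrightarrow> B \<le> a"
    by (rule hdist_bounds[of u w]) (rule that)
  obtain C where C: "hdist z w = 2 * C - plog (im z) - plog (im w)"
    "\<And>a. (plog (im z) \<le> a \<and> plog (im w) \<le> a \<and> (re z = re w \<or> plog (re z - re w) \<le> a)) \<longleftrightarrow> C \<le> a"
    by (rule hdist_bounds[of z w]) (rule that)
  have a: "plog (im z) \<le> A" "plog (im u) \<le> A" "re z - re u = 0 \<or> plog (re z - re u) \<le> A"
    using A(2)[of A] by auto
  have b: "plog (im u) \<le> B" "plog (im w) \<le> B" "re u - re w = 0 \<or> plog (re u - re w) \<le> B"
    using B(2)[of B] by auto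
  have "C \<le> max A B"
    using a b plog_add_le[of "re z - re u" "re u - re w" "max A B"]
    by (subst C(2)[symmetric]) (auto simp: le_max_iff_disj)
  then show ?thesis
    using A(1) B(1) C(1) a b by (auto simp: max_def split: if_splits)
qed

lemma hdist_nonneg: "hdist z w \<ge> 0"
  using hdist_triangle[of z z w] by (simp add: hdist_self hdist_commute[of w])

lemma hdist_cong: "hdist z z' = 0 \<Longrightarrow> hdist w w' = 0 \<Longrightarrow> hdist z w = hdist z' w'"
  using hdist_triangle[of z w z'] hdist_triangle[of z' w w'] hdist_triangle[of z' w' z]
    hdist_triangle[of z w' w]
  by (simp add: hdist_commute[of z' z] hdist_commute[of w' w])

quotient_type tree = hplane / "\<lambda>z w. hdist z w = 0"
proof (rule equivpI)
  show "reflp (\<lambda>z w. hdist z w = 0)"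
    by (simp add: reflp_def hdist_self)
  show "symp (\<lambda>z w. hdist z w = 0)"
    by (simp add: symp_def hdist_commute)
  show "transp (\<lambda>z w. hdist z w = 0)"
  proof (rule transpI)
    fix x y z assume "hdist x y = 0" "hdist y z = 0"
    then show "hdist x z = 0"
      using hdist_cong[of x y z z] by (simp add: hdist_self)
  qed
qed

lift_definition tdist :: "tree \<Rightarrow> tree \<Rightarrow> rat" is hdist
  by (rule hdist_cong)

instantiation tree :: metric_space
begin

definition dist_tree :: "tree \<Rightarrow> tree \<Rightarrow> real" where
  "dist p q = of_rat (tdist p q)"

definition uniformity_tree :: "(tree \<times> tree) filter" where
  "uniformity_tree = (INF e\<in>{0<..}. principal {(x, y). dist x y < e})"

definition open_tree :: "tree set \<Rightarrow> bool" where
  "open_tree U = (\<forall>x\<in>U. \<forall>\<^sub>F (x', y) in uniformity. x' = x \<longrightarrow> y \<in> U)"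

instance
proof
  fix p q r :: tree
  have "tdist p q = 0 \<longleftrightarrow> p = q"
    by transfer simp
  then show "dist p q = 0 \<longleftrightarrow> p = q"
    by (simp add: dist_tree_def)
  have "tdist p q \<le> tdist p r + tdist q r"
    by transfer (metis hdist_commute hdist_triangle)
  then show "dist p q \<le> dist p r + dist q r"
    by (simp add: dist_tree_def of_rat_add[symmetric] of_rat_less_eq)
qed (simp_all add: uniformity_tree_def open_tree_def)

end

definition tree_segment :: "tree set \<Rightarrow> bool" where
  "tree_segment s \<longleftrightarrow> (\<exists>(a::rat) b \<gamma>. a \<le> b \<and>
     (\<forall>t\<in>{a..b}. \<forall>t'\<in>{a..b}. tdist (\<gamma> t) (\<gamma> t') = \<bar>t - t'\<bar>) \<and> s = \<gamma> ` {a..b})"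


section \<open>Metric completion\<close>

lemma Cauchy_dist_convergent:
  fixes X Y :: "nat \<Rightarrow> 'a::metric_space"
  assumes "Cauchy X" "Cauchy Y"
  shows "convergent (\<lambda>n. dist (X n) (Y n))"
proof (rule Cauchy_convergent, rule metric_CauchyI)
  fix e :: real assume "e > 0"
  then obtain M N where
    "\<And>m n. m \<ge> M \<Longrightarrow> n \<ge> M \<Longrightarrow> dist (X m) (X n) < e / 2"
    "\<And>m n. m \<ge> N \<Longrightarrow> n \<ge> N \<Longrightarrow> dist (Y m) (Y n) < e / 2"
    using assms half_gt_zero unfolding Cauchy_def by metis
  moreover have "dist (dist a b) (dist c d) \<le> dist a c + dist b d" for a b c d :: 'a
    unfolding dist_real_def
    by (smt (verit) dist_commute dist_triangle)
  ultimately have "dist (dist (X m) (Y m)) (dist (X n) (Y n)) < e"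
    if "m \<ge> max M N" "n \<ge> max M N" for m n
    using that by (smt (verit) field_sum_of_halves max.bounded_iff)
  then show "\<exists>M. \<forall>m\<ge>M. \<forall>n\<ge>M. dist (dist (X m) (Y m)) (dist (X n) (Y n)) < e"
    by blast
qed

text \<open>Cauchy sequences modulo sequences at distance tending to 0.\<close>

quotient_type (overloaded) 'a completion = "nat \<Rightarrow> 'a::metric_space" /
  partial: "\<lambda>X Y. Cauchy X \<and> Cauchy Y \<and> (\<lambda>n. dist (X n) (Y n)) \<longlonglongrightarrow> 0"
proof (rule part_equivpI)
  show "\<exists>X::nat \<Rightarrow> 'a. Cauchy X \<and> Cauchy X \<and> (\<lambda>n. dist (X n) (X n)) \<longlonglongrightarrow> 0"
    by (rule exI[of _ "\<lambda>_. undefined"]) (simp add: Cauchy_def)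
  show "symp (\<lambda>X Y::nat \<Rightarrow> 'a. Cauchy X \<and> Cauchy Y \<and> (\<lambda>n. dist (X n) (Y n)) \<longlonglongrightarrow> 0)"
    by (simp add: symp_def dist_commute)
  show "transp (\<lambda>X Y::nat \<Rightarrow> 'a. Cauchy X \<and> Cauchy Y \<and> (\<lambda>n. dist (X n) (Y n)) \<longlonglongrightarrow> 0)"
  proof (rule transpI, safe)
    fix X Y Z :: "nat \<Rightarrow> 'a"
    assume "(\<lambda>n. dist (X n) (Y n)) \<longlonglongrightarrow> 0" "(\<lambda>n. dist (Y n) (Z n)) \<longlonglongrightarrow> 0"
    then have "(\<lambda>n. dist (X n) (Y n) + dist (Y n) (Z n)) \<longlonglongrightarrow> 0"
      using tendsto_add_zero by blast
    then show "(\<lambda>n. dist (X n) (Z n)) \<longlonglongrightarrow> 0"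
      by (rule Lim_null_comparison[rotated]) (simp add: dist_triangle)
  qed
qed

instantiation completion :: (metric_space) metric_space
begin

lift_definition dist_completion :: "'a completion \<Rightarrow> 'a completion \<Rightarrow> real"
  is "\<lambda>X Y. lim (\<lambda>n. dist (X n) (Y n))"
proof safe
  fix X X' Y Y' :: "nat \<Rightarrow> 'a"
  assume *: "Cauchy X" "Cauchy Y" "(\<lambda>n. dist (X n) (X' n)) \<longlonglongrightarrow> 0" "(\<lambda>n. dist (Y n) (Y' n)) \<longlonglongrightarrow> 0"
  let ?l = "lim (\<lambda>n. dist (X n) (Y n))"
  have l: "(\<lambda>n. dist (X n) (Y n)) \<longlonglongrightarrow> ?l"
    using Cauchy_dist_convergent[OF *(1,2)] by (simp add: convergent_LIMSEQ_iff)
  have "(\<lambda>n. dist (X n) (X' n) + dist (Y n) (Y' n)) \<longlonglongrightarrow> 0"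
    using *(3,4) tendsto_add_zero by blast
  then have "(\<lambda>n. dist (X' n) (Y' n) - dist (X n) (Y n)) \<longlonglongrightarrow> 0"
    by (rule Lim_null_comparison[rotated])
      (intro always_eventually allI, simp, smt (verit) dist_commute dist_triangle)
  from tendsto_add[OF this l] have "(\<lambda>n. dist (X' n) (Y' n)) \<longlonglongrightarrow> ?l"
    by simp
  then show "?l = lim (\<lambda>n. dist (X' n) (Y' n))"
    by (simp add: limI)
qed

definition uniformity_completion :: "('a completion \<times> 'a completion) filter" where
  "uniformity_completion = (INF e\<in>{0<..}. principal {(x, y). dist x y < e})"

definition open_completion :: "'a completion set \<Rightarrow> bool" where
  "open_completion U = (\<forall>x\<in>U. \<forall>\<^sub>F (x', y) in uniformity. x' = x \<longrightarrow> y \<in> U)"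

instance
proof
  fix p q r :: "'a completion"
  show "dist p q = 0 \<longleftrightarrow> p = q"
  proof (transfer, safe)
    fix X Y :: "nat \<Rightarrow> 'a"
    assume "Cauchy X" "Cauchy Y" "lim (\<lambda>n. dist (X n) (Y n)) = 0"
    then show "(\<lambda>n. dist (X n) (Y n)) \<longlonglongrightarrow> 0"
      using Cauchy_dist_convergent by (metis convergent_LIMSEQ_iff)
  qed (simp add: limI)
  show "dist p q \<le> dist p r + dist q r"
  proof (transfer, elim conjE)
    fix X Y Z :: "nat \<Rightarrow> 'a"
    assume *: "Cauchy X" "Cauchy Y" "Cauchy Z"
    show "lim (\<lambda>n. dist (X n) (Y n)) \<le> lim (\<lambda>n. dist (X n) (Z n)) + lim (\<lambda>n. dist (Y n) (Z n))"
    proof (rule tendsto_le[OF sequentially_bot])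
      show "(\<lambda>n. dist (X n) (Y n)) \<longlonglongrightarrow> lim (\<lambda>n. dist (X n) (Y n))"
        using Cauchy_dist_convergent[OF *(1,2)] by (simp add: convergent_LIMSEQ_iff)
      show "(\<lambda>n. dist (X n) (Z n) + dist (Y n) (Z n)) \<longlonglongrightarrow>
          lim (\<lambda>n. dist (X n) (Z n)) + lim (\<lambda>n. dist (Y n) (Z n))"
        using Cauchy_dist_convergent[OF *(1,3)] Cauchy_dist_convergent[OF *(2,3)]
        by (intro tendsto_add) (simp_all add: convergent_LIMSEQ_iff)
    qed (simp add: dist_triangle2)
  qed
qed (simp_all add: uniformity_completion_def open_completion_def)

end

lift_definition to_completion :: "'a::metric_space \<Rightarrow> 'a completion" is "\<lambda>x _. x"
  by (simp add: Cauchy_def)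

lemma dist_to_completion [simp]: "dist (to_completion x) (to_completion y) = dist x y"
  by transfer (simp add: limI)

lemma to_completion_approx:
  fixes X :: "nat \<Rightarrow> 'a::metric_space"
  assumes "Cauchy X"
  obtains p where "(\<lambda>n. to_completion (X n)) \<longlonglongrightarrow> p"
    "\<And>Y. Cauchy Y \<Longrightarrow> (\<lambda>n. dist (X n) (Y n)) \<longlonglongrightarrow> 0 \<Longrightarrow> abs_completion Y = p"
proof
  have refl: "Cauchy Z \<and> Cauchy Z \<and> (\<lambda>n. dist (Z n) (Z n)) \<longlonglongrightarrow> 0" if "Cauchy Z" for Z :: "nat \<Rightarrow> 'a"
    using that by simp
  have d: "dist (to_completion x) (abs_completion X) = lim (\<lambda>n. dist x (X n))" for x
    using assms
    by (simp add: to_completion.abs_eq dist_completion.abs_eq Cauchy_def)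
  show "(\<lambda>n. to_completion (X n)) \<longlonglongrightarrow> abs_completion X"
  proof (rule metric_LIMSEQ_I)
    fix e :: real assume "e > 0"
    then obtain N where N: "\<And>m n. m \<ge> N \<Longrightarrow> n \<ge> N \<Longrightarrow> dist (X m) (X n) < e / 2"
      using assms half_gt_zero unfolding Cauchy_def by metis
    have "dist (to_completion (X n)) (abs_completion X) < e" if "n \<ge> N" for n
    proof -
      have "(\<lambda>m. dist (X n) (X m)) \<longlonglongrightarrow> lim (\<lambda>m. dist (X n) (X m))"
        using Cauchy_dist_convergent[of "\<lambda>_. X n" X] assms
        by (simp add: convergent_LIMSEQ_iff Cauchy_def)
      then have "lim (\<lambda>m. dist (X n) (X m)) \<le> e / 2"
        using N that by (intro LIMSEQ_le_const2) (auto intro!: exI[of _ N] less_imp_le)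
      then show ?thesis
        using d \<open>e > 0\<close> by simp
    qed
    then show "\<exists>N. \<forall>n\<ge>N. dist (to_completion (X n)) (abs_completion X) < e"
      by blast
  qed
  fix Y assume "Cauchy Y" "(\<lambda>n. dist (X n) (Y n)) \<longlonglongrightarrow> 0"
  then show "abs_completion Y = abs_completion X"
    using assms Quotient_rel_abs[OF Quotient_completion] by (metis (mono_tags, lifting))
qed

lemma to_completion_dense: "closure (range to_completion) = UNIV"
proof -
  have "p \<in> closure (range to_completion)" for p :: "'a completion"
  proof -
    obtain X where X: "Cauchy X" "p = abs_completion X"
      using Quotient_abs_rep[OF Quotient_completion, of p]
        Quotient_rep_reflp[OF Quotient_completion, of p] by metis
    obtain q where "(\<lambda>n. to_completion (X n)) \<longlonglongrightarrow> q"
      "\<And>Y. Cauchy Y \<Longrightarrow> (\<lambda>n. dist (X n) (Y n)) \<longlonglongrightarrow> 0 \<Longrightarrow> abs_completion Y = q"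
      using to_completion_approx[OF X(1)] by metis
    with X show ?thesis
      unfolding closure_sequential by (intro exI[of _ "\<lambda>n. to_completion (X n)"]) auto
  qed
  then show ?thesis by blast
qed

instance completion :: (metric_space) complete_space
proof
  fix P :: "nat \<Rightarrow> 'a completion"
  assume P: "Cauchy P"
  have "\<exists>x. dist (to_completion x) (P n) < inverse (real (Suc n))" for n
    using to_completion_dense closure_approachable[of "P n" "range to_completion"] by auto
  then obtain x where x: "\<And>n. dist (to_completion (x n)) (P n) < inverse (real (Suc n))"
    by metis
  have lim: "(\<lambda>n. dist (to_completion (x n)) (P n)) \<longlonglongrightarrow> 0"
    by (rule Lim_null_comparison[OF _ LIMSEQ_inverse_real_of_nat])
      (use x in \<open>auto intro!: always_eventually less_imp_le\<close>)
  have "Cauchy x"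
  proof (rule metric_CauchyI)
    fix e :: real assume e: "e > 0"
    obtain M where M: "\<And>n. n \<ge> M \<Longrightarrow> dist (to_completion (x n)) (P n) < e / 3"
      using metric_LIMSEQ_D[OF lim, of "e / 3"] e by auto
    obtain N where N: "\<And>m n. m \<ge> N \<Longrightarrow> n \<ge> N \<Longrightarrow> dist (P m) (P n) < e / 3"
      using metric_CauchyD[OF P, of "e / 3"] e by auto
    have "dist (x m) (x n) < e" if "m \<ge> max M N" "n \<ge> max M N" for m n
    proof -
      have "dist (x m) (x n) \<le> dist (to_completion (x m)) (P m) + dist (P m) (P n)
          + dist (to_completion (x n)) (P n)"
        using dist_triangle[of "to_completion (x m)" "to_completion (x n)" "P m"]
          dist_triangle2[of "P m" "to_completion (x n)" "P n"] by simp
      then show ?thesis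
        using M[of m] M[of n] N[of m n] that by simp
    qed
    then show "\<exists>M. \<forall>m\<ge>M. \<forall>n\<ge>M. dist (x m) (x n) < e" by blast
  qed
  then obtain p where p: "(\<lambda>n. to_completion (x n)) \<longlonglongrightarrow> p"
    using to_completion_approx by metis
  have "(\<lambda>n. dist (to_completion (x n)) (P n) + dist (to_completion (x n)) p) \<longlonglongrightarrow> 0"
    using lim p tendsto_add_zero tendsto_dist_iff by blast
  then have "(\<lambda>n. dist (P n) p) \<longlonglongrightarrow> 0"
    by (rule Lim_null_comparison[rotated]) (simp add: dist_triangle3)
  then show "convergent P"
    using convergentI tendsto_dist_iff by blast
qed

definition tree_sc :: "tree completion set" where
  "tree_sc = (\<Union>s\<in>{s. tree_segment s}. closure (to_completion ` s))"

lemma to_completion_in_tree_sc: "to_completion p \<in> tree_sc"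
proof -
  have "tdist p p = 0"
    by transfer (rule hdist_self)
  then have "tree_segment {p}"
    unfolding tree_segment_def
    by (intro exI[of _ 0] exI[of _ "\<lambda>_. p"]) auto
  then show ?thesis
    using closure_subset by (fastforce simp: tree_sc_def)
qed

end

theory Submission
  imports Defs
begin

text \<open>
  A point \<open>x + i y\<close> of the tree is a ball: the series that agree with \<open>x\<close> above the exponent
  \<open>log y\<close>. The balls with centre \<open>x\<^sub>n = \<Sum>k<n. X^(1/(k+1))\<close> and radius
  exponent \<open>1/(n+1)\<close> are nested, and their mutual distances are differences of the
  \<open>1/(n+1)\<close>, so they form a Cauchy sequence. A common element of all of them would
  have the coefficients of \<open>\<Sum>k. X^(1/(k+1))\<close> at all positive exponents, which have no common
  denominator; so the balls have empty intersection.

  A limit in the segment completion would nearly provide such an element. A geodesic between \<open>z\<close> and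
  \<open>w\<close> first enlarges the ball of \<open>z\<close> and then shrinks towards the ball of \<open>w\<close>, so each
  of its points is a ball centred at the real part of \<open>z\<close> or of \<open>w\<close>
  (lemma \<open>between_imp_common_centre\<close>). If points of one segment come arbitrarily close
  to the sequence, then for every \<open>k\<close> one of the two real parts has the same coefficient at
  \<open>1/(k+1)\<close> as the \<open>x\<^sub>n\<close> with large \<open>n\<close>, namely 1. Since these two series
  have a common denominator, this fails for a suitable \<open>k\<close>.
\<close>

section \<open>Distances and agreement of coefficients\<close>

definition agree_above :: "rat \<Rightarrow> puiseux \<Rightarrow> puiseux \<Rightarrow> bool" where
  "agree_above a f g \<longleftrightarrow> (\<forall>q>a. pcoeff f q = pcoeff g q)"

lemma agree_above_iff_plog: "agree_above a f g \<longleftrightarrow> f = g \<or> plog (f - g) \<le> a"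
proof
  assume agree: "agree_above a f g"
  show "f = g \<or> plog (f - g) \<le> a"
  proof (rule ccontr)
    assume "\<not> (f = g \<or> plog (f - g) \<le> a)"
    then have "lead (f - g) \<noteq> 0" "plog (f - g) > a"
      by (simp_all only: lead_eq_0_iff right_minus_eq) auto
    with agree show False
      by (simp add: agree_above_def)
  qed
next
  assume "f = g \<or> plog (f - g) \<le> a"
  then show "agree_above a f g"
    unfolding agree_above_def using le_plog[of "f - g"] by fastforce
qed

text \<open>The number \<open>M\<close> is the radius exponent of the smallest ball containing the balls of
  \<open>z\<close> and \<open>w\<close>, the turning point of the geodesic between them.\<close>

lemma hdist_join:
  obtains M where "hdist z w = 2 * M - plog (im z) - plog (im w)"
    "plog (im z) \<le> M" "plog (im w) \<le> M" "agree_above M (re z) (re w)"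
    "\<And>a. plog (im z) \<le> a \<Longrightarrow> plog (im w) \<le> a \<Longrightarrow> agree_above a (re z) (re w) \<Longrightarrow> M \<le> a"
proof -
  obtain M where "hdist z w = 2 * M - plog (im z) - plog (im w)"
    "\<And>a. (plog (im z) \<le> a \<and> plog (im w) \<le> a \<and> (re z = re w \<or> plog (re z - re w) \<le> a))
       \<longleftrightarrow> M \<le> a"
    by (rule hdist_bounds[of z w]) (rule that)
  then show thesis
    using that[of M] unfolding agree_above_iff_plog by blast
qed

text \<open>With \<open>A\<close>, \<open>B\<close> and \<open>C\<close> the turning points for the pairs \<open>(z, u)\<close>,
  \<open>(u, w)\<close> and \<open>(z, w)\<close>, additivity of the distance says \<open>A + B - log (im u) = C\<close>,
  while the ultrametric inequality gives \<open>C \<le> max A B\<close>. So the smaller of \<open>A\<close> and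
  \<open>B\<close> is at most \<open>log (im u)\<close>.\<close>

lemma between_imp_common_centre:
  assumes "hdist z u + hdist u w = hdist z w"
  shows "agree_above (plog (im u)) (re z) (re u) \<or> agree_above (plog (im u)) (re w) (re u)"
proof -
  obtain A where A: "hdist z u = 2 * A - plog (im z) - plog (im u)"
    "plog (im z) \<le> A" "plog (im u) \<le> A" "agree_above A (re z) (re u)"
    by (rule hdist_join)
  obtain B where B: "hdist u w = 2 * B - plog (im u) - plog (im w)"
    "plog (im u) \<le> B" "plog (im w) \<le> B" "agree_above B (re u) (re w)"
    by (rule hdist_join)
  obtain C where C: "hdist z w = 2 * C - plog (im z) - plog (im w)"
    "\<And>a. plog (im z) \<le> a \<Longrightarrow> plog (im w) \<le> a \<Longrightarrow> agree_above a (re z) (re w) \<Longrightarrow> C \<le> a"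
    by (rule hdist_join[of z w]) (rule that)
  have "agree_above (max A B) (re z) (re w)"
    using A(4) B(4) by (simp add: agree_above_def)
  then have "C \<le> max A B"
    using A(2) B(3) by (intro C(2)) auto
  moreover have "A + B - plog (im u) = C"
    using assms A(1) B(1) C(1) by simp
  ultimately have "A = plog (im u) \<or> B = plog (im u)"
    using A(3) B(2) by (auto simp: max_def split: if_splits)
  then show ?thesis
    using A(4) B(4) by (auto simp: agree_above_def)
qed

text \<open>The turning point \<open>M\<close> of two close points is only slightly above both of their radius
  exponents: \<open>(M - log (im u)) + (M - log (im v))\<close> is the distance, and both terms are
  nonnegative.\<close>

lemma agree_above_of_close:
  assumes "hdist u v < e" "agree_above (plog (im u)) f (re u)"
  shows "agree_above (plog (im v) + e) f (re v)"
proof -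
  obtain M where "hdist u v = 2 * M - plog (im u) - plog (im v)"
    "plog (im u) \<le> M" "plog (im v) \<le> M" "agree_above M (re u) (re v)"
    by (rule hdist_join)
  moreover from this(1,2) assms(1) have "M \<le> plog (im v) + e"
    by linarith
  ultimately show ?thesis
    using assms(2) by (simp add: agree_above_def)
qed

lemma tdist_abs_tree: "tdist (abs_tree z) (abs_tree w) = hdist z w"
  by (rule tdist.abs_eq)

lemma tree_segmentE:
  assumes "tree_segment s"
  obtains z w where "\<And>u. abs_tree u \<in> s \<Longrightarrow> hdist z u + hdist u w = hdist z w"
proof -
  obtain a b \<gamma> where \<gamma>: "a \<le> b" "s = \<gamma> ` {a..b}"
    "\<And>t t'. t \<in> {a..b} \<Longrightarrow> t' \<in> {a..b} \<Longrightarrow> tdist (\<gamma> t) (\<gamma> t') = \<bar>t - t'\<bar>"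
    using assms unfolding tree_segment_def by blast
  obtain z w where zw: "\<gamma> a = abs_tree z" "\<gamma> b = abs_tree w"
    using tree.abs_induct[of "\<lambda>p. \<exists>z. p = abs_tree z"] by metis
  show thesis
  proof (rule that)
    fix u assume "abs_tree u \<in> s"
    then obtain t where t: "t \<in> {a..b}" "abs_tree u = \<gamma> t"
      using \<gamma>(2) by blast
    then have "tdist (\<gamma> a) (\<gamma> t) + tdist (\<gamma> t) (\<gamma> b) = tdist (\<gamma> a) (\<gamma> b)"
      using \<gamma>(1) by (simp add: \<gamma>(3))
    then show "hdist z u + hdist u w = hdist z w"
      unfolding t(2)[symmetric] zw tdist_abs_tree .
  qed
qed

text \<open>The series \<open>f\<close> and \<open>g\<close> are the real parts of the ends of a segment whose closure
  contains the limit; points of the segment near the limit transfer their centres to the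
  sequence.\<close>

lemma agree_above_of_tree_sc_limit:
  assumes "p \<in> tree_sc" "(\<lambda>n. to_completion (abs_tree (v n))) \<longlonglongrightarrow> p"
  obtains f g where "\<And>e. e > 0 \<Longrightarrow> \<forall>\<^sub>F n in sequentially.
    agree_above (plog (im (v n)) + e) f (re (v n)) \<or> agree_above (plog (im (v n)) + e) g (re (v n))"
proof -
  obtain s where s: "tree_segment s" "p \<in> closure (to_completion ` s)"
    using assms(1) by (auto simp: tree_sc_def)
  obtain z w where zw: "\<And>u. abs_tree u \<in> s \<Longrightarrow> hdist z u + hdist u w = hdist z w"
    using s(1) by (rule tree_segmentE) (rule that)
  show thesis
  proof (rule that)
    fix e :: rat assume "e > 0"
    then have e: "real_of_rat e / 2 > 0"
      by simp
    obtain q where q: "q \<in> s" "dist (to_completion q) p < real_of_rat e / 2"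
      using s(2) e unfolding closure_approachable by blast
    obtain u where u: "q = abs_tree u"
      using tree.abs_induct[of "\<lambda>p. \<exists>z. p = abs_tree z"] by metis
    have close: "hdist u (v n) < e"
      if "dist (to_completion (abs_tree (v n))) p < real_of_rat e / 2" for n
    proof -
      have "dist (to_completion q) (to_completion (abs_tree (v n))) < real_of_rat e"
        using q(2) that by (rule dist_triangle_half_l)
      then show ?thesis
        by (simp add: dist_tree_def u tdist_abs_tree of_rat_less)
    qed
    show "\<forall>\<^sub>F n in sequentially. agree_above (plog (im (v n)) + e) (re z) (re (v n)) \<or>
        agree_above (plog (im (v n)) + e) (re w) (re (v n))"
      using tendstoD[OF assms(2) e]
    proof eventually_elim
      case (elim n)
      show ?case
        using between_imp_common_centre[OF zw] q(1) agree_above_of_close[OF close[OF elim]]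
        unfolding u by blast
    qed
  qed
qed

section \<open>A nested sequence of balls without common centre\<close>

lift_definition puiseux_monom :: "rat \<Rightarrow> puiseux" is "\<lambda>r q. if q = r then 1 else 0"
proof goal_cases
  case (1 r)
  obtain a b where "quotient_of r = (a, b)"
    by (cases "quotient_of r")
  then have "r = of_int a / of_nat (nat b)" "nat b > 0"
    using quotient_of_div[of r a b] quotient_of_denom_pos[of r a b] by simp_all
  then show ?case
    by (intro exI[of _ "nat b"] exI[of _ a]) auto
qed

lemma plog_puiseux_monom: "plog (puiseux_monom r) = r"
  by (rule plog_eqI) (simp_all add: puiseux_monom.rep_eq)

lemma puiseux_monom_pos: "puiseux_monom r > 0"
  by (simp add: puiseux_pos_iff plog_puiseux_monom puiseux_monom.rep_eq)

lemma pcoeff_sum: "pcoeff (sum f A) q = (\<Sum>k\<in>A. pcoeff (f k) q)"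
  by (induction A rule: infinite_finite_induct) simp_all

definition harmonic_point :: "nat \<Rightarrow> hplane" where
  "harmonic_point n = Abs_hplane
     (\<Sum>k<n. puiseux_monom (1 / of_nat (Suc k)), puiseux_monom (1 / of_nat (Suc n)))"

lemma re_harmonic_point: "re (harmonic_point n) = (\<Sum>k<n. puiseux_monom (1 / of_nat (Suc k)))"
  and plog_im_harmonic_point: "plog (im (harmonic_point n)) = 1 / of_nat (Suc n)"
  unfolding re_def im_def harmonic_point_def
  by (simp_all add: Abs_hplane_inverse puiseux_monom_pos plog_puiseux_monom)

lemma pcoeff_re_harmonic_point:
  assumes "k < n"
  shows "pcoeff (re (harmonic_point n)) (1 / of_nat (Suc k)) = 1"
proof -
  have "(1 / of_nat (Suc k) = (1 / of_nat (Suc j) :: rat)) \<longleftrightarrow> j = k" for j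
    unfolding divide_cancel_left of_nat_eq_iff by auto
  then show ?thesis
    using assms by (simp add: re_harmonic_point pcoeff_sum puiseux_monom.rep_eq del: of_nat_Suc)
qed

lemma agree_above_harmonic_point:
  assumes "n \<le> m"
  shows "agree_above (1 / of_nat (Suc n)) (re (harmonic_point n)) (re (harmonic_point m))"
  unfolding agree_above_def
proof (intro allI impI)
  fix q :: rat assume q: "1 / of_nat (Suc n) < q"
  have "pcoeff (puiseux_monom (1 / of_nat (Suc k))) q = 0" if "n \<le> k" for k
  proof -
    have "1 / of_nat (Suc k) \<le> (1 / of_nat (Suc n) :: rat)"
      using that by (intro divide_left_mono) auto
    with q show ?thesis
      by (simp add: puiseux_monom.rep_eq)
  qed
  then show "pcoeff (re (harmonic_point n)) q = pcoeff (re (harmonic_point m)) q"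
    using assms unfolding re_harmonic_point pcoeff_sum
    by (intro sum.mono_neutral_left) auto
qed

lemma hdist_harmonic_point:
  assumes "n \<le> m"
  shows "hdist (harmonic_point n) (harmonic_point m) \<le> 1 / of_nat (Suc n)"
proof -
  let ?r = "\<lambda>n. 1 / of_nat (Suc n) :: rat"
  obtain M where M: "hdist (harmonic_point n) (harmonic_point m) = 2 * M - ?r n - ?r m"
    "\<And>a. ?r n \<le> a \<Longrightarrow> ?r m \<le> a \<Longrightarrow>
      agree_above a (re (harmonic_point n)) (re (harmonic_point m)) \<Longrightarrow> M \<le> a"
    using hdist_join[of "harmonic_point n" "harmonic_point m"]
    unfolding plog_im_harmonic_point by metis
  have "?r m \<le> ?r n"
    using assms by (intro divide_left_mono) auto
  then have "M \<le> ?r n"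
    using agree_above_harmonic_point[OF assms] by (intro M(2)) auto
  moreover have "0 \<le> ?r m"
    by simp
  ultimately show ?thesis
    using M(1) by linarith
qed

lemma Cauchy_harmonic_point: "Cauchy (\<lambda>n. to_completion (abs_tree (harmonic_point n)))"
proof (rule CauchyI')
  fix e :: real assume "e > 0"
  then obtain N where N: "1 / real (Suc N) < e"
    using nat_approx_posE by blast
  have "dist (to_completion (abs_tree (harmonic_point m))) (to_completion (abs_tree (harmonic_point n))) < e"
    if "m \<ge> N" "n > m" for m n
  proof -
    have "dist (abs_tree (harmonic_point m)) (abs_tree (harmonic_point n))
        \<le> real_of_rat (1 / of_nat (Suc m))"
      unfolding dist_tree_def tdist_abs_tree of_rat_less_eq
      using that by (intro hdist_harmonic_point) simp
    also have "\<dots> = 1 / real (Suc m)"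
      by (simp only: of_rat_divide of_rat_1 of_rat_of_nat_eq)
    also have "\<dots> \<le> 1 / real (Suc N)"
      using that by (intro divide_left_mono) auto
    finally show ?thesis
      using N by simp
  qed
  then show "\<exists>M. \<forall>m\<ge>M. \<forall>n>m.
      dist (to_completion (abs_tree (harmonic_point m))) (to_completion (abs_tree (harmonic_point n))) < e"
    by blast
qed

lemma common_missing_unit_fraction:
  obtains k where "pcoeff f (1 / of_nat (Suc k)) = 0" "pcoeff g (1 / of_nat (Suc k)) = 0"
proof -
  obtain m F G where *: "m > 0" "f = of_fls m F" "g = of_fls m G"
    by (rule common_of_fls[of f g g])
  \<comment> \<open>The exponent \<open>1/(m+1)\<close> does not lie in \<open>\<int>/m\<close>.\<close>
  have "1 / of_nat (Suc m) * of_nat m \<notin> (\<int> :: rat set)"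
  proof
    assume "1 / of_nat (Suc m) * of_nat m \<in> (\<int> :: rat set)"
    then obtain i :: int where "(1 / of_nat (Suc m) * of_nat m :: rat) = of_int i"
      by (elim Ints_cases)
    moreover have "0 < (1 / of_nat (Suc m) * of_nat m :: rat)" "(1 / of_nat (Suc m) * of_nat m :: rat) < 1"
      using *(1) by (simp_all add: divide_simps)
    ultimately show False
      by simp
  qed
  then have "pcoeff (of_fls m H) (1 / of_nat (Suc m)) = 0" for H
    by (simp add: of_fls.rep_eq del: of_nat_Suc)
  then show thesis
    using that[of m] * by simp
qed

theorem theorem1:
  shows "\<not> complete tree_sc"
proof
  assume "complete tree_sc"
  then obtain p where p: "p \<in> tree_sc" "(\<lambda>n. to_completion (abs_tree (harmonic_point n))) \<longlonglongrightarrow> p"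
    by (rule completeE[OF _ _ Cauchy_harmonic_point]) (use to_completion_in_tree_sc in auto)
  let ?h = harmonic_point
  obtain f g where fg: "\<And>e. e > 0 \<Longrightarrow> \<forall>\<^sub>F n in sequentially.
      agree_above (plog (im (?h n)) + e) f (re (?h n)) \<or> agree_above (plog (im (?h n)) + e) g (re (?h n))"
    using p by (rule agree_above_of_tree_sc_limit) (rule that)
  obtain k where k: "pcoeff f (1 / of_nat (Suc k)) = 0" "pcoeff g (1 / of_nat (Suc k)) = 0"
    by (rule common_missing_unit_fraction)
  \<comment> \<open>Half of \<open>1/(k+1)\<close>: once \<open>1/(n+1) < e\<close>, that is \<open>n > 2k+1\<close>, agreement above
    \<open>1/(n+1) + e\<close> covers the exponent \<open>1/(k+1)\<close>.\<close>
  define e :: rat where "e = 1 / of_nat (Suc k) / 2"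
  have "e > 0"
    by (simp add: e_def)
  have "\<forall>\<^sub>F n in sequentially. n > 2 * k + 1"
    by (rule eventually_gt_at_top)
  then obtain n where n: "n > 2 * k + 1"
    "agree_above (1 / of_nat (Suc n) + e) f (re (?h n)) \<or> agree_above (1 / of_nat (Suc n) + e) g (re (?h n))"
    using eventually_happens'[OF sequentially_bot eventually_conj[OF _ fg[OF \<open>e > 0\<close>]]]
    unfolding plog_im_harmonic_point by blast
  have "1 / of_nat (Suc n) < (1 / of_nat (2 * Suc k) :: rat)"
    using n(1) by (intro divide_strict_left_mono) (simp_all only: of_nat_less_iff of_nat_0_less_iff, auto)
  also have "\<dots> = e"
    by (simp add: e_def)
  finally have "1 / of_nat (Suc n) + e < e + e"
    by simp
  also have "e + e = 1 / of_nat (Suc k)"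
    by (simp add: e_def del: of_nat_Suc)
  finally have "1 / of_nat (Suc n) + e < 1 / of_nat (Suc k)" .
  then have "pcoeff f (1 / of_nat (Suc k)) = 1 \<or> pcoeff g (1 / of_nat (Suc k)) = 1"
    using n pcoeff_re_harmonic_point[of k n] by (auto simp: agree_above_def simp del: of_nat_Suc)
  with k show False
    by simp
qed

end
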